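(* Let $M$ be a nonempty matroid. Then $M\in\mathcal E_3$ if and only if $M$ arises from a Bose–Burton geometry of order $1$ or $2$ by a sequence of semidoublings.
   Context: A simple binary matroid (here just "matroid") is a pair $M=(E,G)$, where $G$ is identified with $\mathbb F_2^n\setminus\{0\}$ and $E\subseteq G$; $M$ is nonempty if $E\neq\emptyset$. A flat of $G$ is a set $V\setminus\{0\}$ with $V$ a subspace, of dimension $\dim V$; a hyperplane is a flat of dimension $n-1$. $\mathcal E_3$ is the class of matroids $(E,G)$ with $|E\cap F|$ even for every flat $F$ of dimension at least $3$. A Bose–Burton geometry of order $k$ is a matroid $(G\setminus F,G)$ with $F$ a flat of $G$ of dimension $\dim G-k$. Given $M_0=(E_0,G_0)$, a projective geometry $G$ containing $G_0$ as a hyperplane, $w\in G\setminus G_0$ and a hyperplane $H_0$ of $G_0$, the semidoubling of $M_0$ with respect to $H_0$ is $(E_0\cup\{w+x:x\in E_0\triangle(G_0\setminus H_0)\},G)$. "Arises from $M_0$ by a sequence of semidoublings" means there are $M_0,\dots,M_s$ with $M_s\cong M$ and each $M_{i+1}$ isomorphic to a semidoubling of $M_i$ (isomorphism = bijective linear map of geometries carrying ground set onto ground set). *)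

theory Defs
  imports Complex_Main "HOL-Library.Z2" "HOL-Library.Function_Algebras"
begin

text \<open>
  All geometries live inside one ambient space, the space of infinite sequences over the field
  \<open>bit\<close> with two elements. Its dimension is infinite, so for each \<open>n\<close> it contains a copy of
  the \<open>n\<close>-dimensional space over the two-element field, and each of its finite-dimensional
  subspaces is a hyperplane of a larger one.
\<close>

type_synonym vec2 = "nat \<Rightarrow> bit"

definition scale2 :: "bit \<Rightarrow> vec2 \<Rightarrow> vec2"
  where "scale2 c v = (\<lambda>i. c * v i)"

global_interpretation F2: vector_space scale2
  by standard (auto simp: scale2_def fun_eq_iff algebra_simps)

text \<open>Over the two-element field, a subspace has finite dimension iff it is a finite set.\<close>

definition proj_geometry :: "vec2 set \<Rightarrow> bool"
  where "proj_geometry G \<longleftrightarrow> (\<exists>V. F2.subspace V \<and> finite V \<and> G = V - {0})"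

definition flat_of :: "vec2 set \<Rightarrow> vec2 set \<Rightarrow> bool"
  where "flat_of F G \<longleftrightarrow> F \<subseteq> G \<and> (\<exists>V. F2.subspace V \<and> F = V - {0})"

text \<open>For a flat \<open>F = V - {0}\<close> the argument of \<open>F2.dim\<close> below is the subspace \<open>V\<close>.\<close>

definition flat_dim :: "vec2 set \<Rightarrow> nat"
  where "flat_dim F = F2.dim (insert 0 F)"

definition hyperplane_of :: "vec2 set \<Rightarrow> vec2 set \<Rightarrow> bool"
  where "hyperplane_of H G \<longleftrightarrow> flat_of H G \<and> flat_dim H + 1 = flat_dim G"

text \<open>A pair \<open>(E, G)\<close>; the empty geometry (dimension 0) is allowed.\<close>

type_synonym matroid = "vec2 set \<times> vec2 set"

definition is_matroid :: "matroid \<Rightarrow> bool"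
  where "is_matroid M \<longleftrightarrow> proj_geometry (snd M) \<and> fst M \<subseteq> snd M"

definition nonempty_matroid :: "matroid \<Rightarrow> bool"
  where "nonempty_matroid M \<longleftrightarrow> is_matroid M \<and> fst M \<noteq> {}"

definition class_E3 :: "matroid set"
  where "class_E3 = {(E, G). is_matroid (E, G) \<and>
    (\<forall>F. flat_of F G \<and> flat_dim F \<ge> 3 \<longrightarrow> even (card (E \<inter> F)))}"

definition bose_burton :: "nat \<Rightarrow> matroid \<Rightarrow> bool"
  where "bose_burton k M \<longleftrightarrow> (\<exists>F G. proj_geometry G \<and> flat_of F G \<and>
    flat_dim F + k = flat_dim G \<and> M = (G - F, G))"

definition semidoubling_set :: "vec2 set \<Rightarrow> vec2 set \<Rightarrow> vec2 set \<Rightarrow> vec2 \<Rightarrow> vec2 set"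
  where "semidoubling_set E0 G0 H0 w = E0 \<union> {w + x | x. x \<in> sym_diff E0 (G0 - H0)}"

definition semidoubling_of :: "matroid \<Rightarrow> matroid \<Rightarrow> bool"
  where "semidoubling_of M0 M \<longleftrightarrow> (\<exists>E0 G0 G w H0. M0 = (E0, G0) \<and> is_matroid M0 \<and>
    proj_geometry G \<and> hyperplane_of G0 G \<and> w \<in> G - G0 \<and> hyperplane_of H0 G0 \<and>
    M = (semidoubling_set E0 G0 H0 w, G))"

text \<open>
  The map \<open>f\<close> is linear on the whole ambient space. This is no restriction: a linear map
  defined on a subspace extends to the ambient space.
\<close>

definition matroid_iso :: "matroid \<Rightarrow> matroid \<Rightarrow> bool"
  where "matroid_iso M N \<longleftrightarrow> is_matroid M \<and> is_matroid N \<and>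
    (\<exists>f. Vector_Spaces.linear scale2 scale2 f \<and> bij_betw f (snd M) (snd N) \<and> f ` fst M = fst N)"

definition arises_by_semidoublings :: "matroid \<Rightarrow> matroid \<Rightarrow> bool"
  where "arises_by_semidoublings M0 M \<longleftrightarrow> (\<exists>(s::nat) (Ms :: nat \<Rightarrow> matroid).
    Ms 0 = M0 \<and>
    (\<forall>i<s. \<exists>N. semidoubling_of (Ms i) N \<and> matroid_iso (Ms (Suc i)) N) \<and>
    matroid_iso (Ms s) M)"

end

theory Submission imports Defs begin

text \<open>
  A matroid lies in \<open>class_E3\<close> iff the indicator function \<open>f\<close> of its ground set is a quadratic form,
  i.e. \<open>B x y = f (x + y) + f x + f y\<close> is bilinear. If some \<open>w \<noteq> 0\<close> with \<open>f w = 0\<close> lies outside the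
  radical of \<open>B\<close>, then for each hyperplane avoiding \<open>w\<close> the matroid is the semidoubling, by \<open>w\<close> and
  the kernel of \<open>B w\<close>, of its restriction to that hyperplane; the hyperplane may be chosen to meet
  the ground set. Otherwise the zeros of \<open>f\<close> lie in the radical and form a subspace, and its
  codimension is at most 2, as three vectors independent modulo it would span a flat with seven
  elements, all in the ground set. Conversely, semidoubling adds to a quadratic form the product of
  two linear forms, and a flat of dimension at least 3 meets every flat of codimension at most 2.
\<close>

text \<open>These rewrite bit arithmetic to boolean connectives, which blocks cancellation.\<close>
declare add_bit_eq_xor [simp del] mult_bit_eq_and [simp del]

section \<open>Arithmetic in characteristic two\<close>

lemma bit_add_self [simp]: "(b::bit) + b = 0"
  by (cases b) simp_all

lemma bit_add_self_left [simp]: "(b::bit) + (b + c) = c"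
  by (simp add: add.assoc [symmetric])

lemma vec2_add_self [simp]: "(x::vec2) + x = 0"
  by (simp add: fun_eq_iff)

lemma vec2_add_self_left [simp]: "(x::vec2) + (x + y) = y"
  by (simp add: add.assoc [symmetric])

lemma vec2_mem_translation_iff: "(x::vec2) \<in> (+) w ` T \<longleftrightarrow> w + x \<in> T"
  by (metis image_iff vec2_add_self_left)

lemma vec2_diff: "(x::vec2) - y = x + y"
  by (simp add: fun_eq_iff)

lemma scale2_simps [simp]: "scale2 0 x = 0" "scale2 1 x = x"
  by (simp_all add: scale2_def fun_eq_iff)

section \<open>Subspaces, spans and their cardinalities over the two-element field\<close>

lemma subspace_iff: "F2.subspace S \<longleftrightarrow> 0 \<in> S \<and> (\<forall>x\<in>S. \<forall>y\<in>S. x + y \<in> S)"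
proof -
  have "scale2 c x \<in> S" if "0 \<in> S" "x \<in> S" for c x
    using that by (cases c) auto
  then show ?thesis by (auto simp: F2.subspace_def)
qed

lemma add_in_subspace_iff:
  assumes "F2.subspace S" "x \<in> S"
  shows "x + y \<in> S \<longleftrightarrow> y \<in> S"
  using assms by (metis subspace_iff vec2_add_self_left)

lemma span_insert_eq: "F2.span (insert a S) = F2.span S \<union> (+) a ` F2.span S"
proof -
  have "x \<in> F2.span (insert a S) \<longleftrightarrow> x \<in> F2.span S \<or> a + x \<in> F2.span S" for x
  proof -
    have "(\<exists>k. P (scale2 k a)) \<longleftrightarrow> P 0 \<or> P a" for P
      by (metis scale2_simps bit.exhaust)
    from this [of "\<lambda>z. x - z \<in> F2.span S"] show ?thesis
      by (simp add: F2.span_breakdown_eq vec2_diff add.commute)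
  qed
  then show ?thesis by (intro set_eqI) (simp only: Un_iff vec2_mem_translation_iff)
qed

lemma finite_span: "finite S \<Longrightarrow> finite (F2.span S)"
  by (induction S rule: finite_induct) (simp_all add: span_insert_eq)

text \<open>The span is the disjoint union of \<open>F2.span S\<close> and its translate by
  \<open>a\<close>. The constant \<open>g = 1\<close> gives cardinalities, an indicator gives
  parities.\<close>

lemma sum_span_insert:
  assumes "finite (F2.span S)" "a \<notin> F2.span S"
  shows "sum g (F2.span (insert a S)) = (\<Sum>x\<in>F2.span S. g x + g (a + x))"
proof -
  have "F2.span S \<inter> (+) a ` F2.span S = {}"
    using assms(2) add_in_subspace_iff [OF F2.subspace_span] by (auto simp: add.commute)
  moreover have "sum g ((+) a ` F2.span S) = (\<Sum>x\<in>F2.span S. g (a + x))"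
    by (subst sum.reindex) auto
  ultimately show ?thesis
    using assms(1) by (simp add: span_insert_eq sum.union_disjoint sum.distrib)
qed

lemma card_span_insert:
  assumes "finite (F2.span S)" "a \<notin> F2.span S"
  shows "card (F2.span (insert a S)) = 2 * card (F2.span S)"
  using sum_span_insert [OF assms, of "\<lambda>_. 1::nat"] by simp

lemma card_span_independent:
  assumes "finite B" "F2.independent B"
  shows "card (F2.span B) = 2 ^ card B"
  using assms
proof (induction B rule: finite_induct)
  case (insert a B)
  then have "a \<notin> F2.span B" "F2.independent B"
    by (auto simp: F2.independent_insert)
  with insert show ?case
    by (simp add: card_span_insert finite_span)
qed simp

lemma card_subspace:
  assumes "F2.subspace V" "finite V"
  shows "card V = 2 ^ F2.dim V"
proof -
  obtain B where B: "B \<subseteq> V" "F2.independent B" "V \<subseteq> F2.span B" "card B = F2.dim V"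
    using F2.basis_exists by blast
  then have "F2.span B = V"
    using assms by (simp add: F2.span_minimal subset_antisym)
  then show ?thesis
    using B assms card_span_independent finite_subset by metis
qed

lemma even_card_subspace:
  assumes "F2.subspace V" "finite V" "x \<in> V" "x \<noteq> 0"
  shows "even (card V)"
proof -
  have "card V \<noteq> 1"
    using assms by (metis card_1_singletonE singletonD subspace_iff)
  then show ?thesis
    using card_subspace [OF assms(1,2)] by (cases "F2.dim V") auto
qed

section \<open>Flats and hyperplanes, with codimension expressed by counting\<close>

lemma dim_add_eq_iff_card:
  assumes "F2.subspace U" "F2.subspace V" "finite U" "finite V"
  shows "F2.dim U + k = F2.dim V \<longleftrightarrow> card V = 2 ^ k * card U"
  using card_subspace [OF assms(1,3)] card_subspace [OF assms(2,4)]
  by (metis add.commute power_add power_inject_exp one_less_numeral_iff semiring_norm(76))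

lemma flat_dim_eq_dim: "F2.subspace V \<Longrightarrow> flat_dim (V - {0}) = F2.dim V"
  by (simp add: flat_dim_def insert_absorb subspace_iff)

lemma hyperplane_of_iff_card:
  assumes "F2.subspace U" "F2.subspace V" "finite U" "finite V"
  shows "hyperplane_of (U - {0}) (V - {0}) \<longleftrightarrow> U \<subseteq> V \<and> card V = 2 * card U"
proof -
  have "U - {0} \<subseteq> V - {0} \<longleftrightarrow> U \<subseteq> V"
    using assms by (auto simp: subspace_iff)
  then show ?thesis
    using assms dim_add_eq_iff_card [OF assms, of 1]
    by (auto simp: hyperplane_of_def flat_of_def flat_dim_eq_dim)
qed

lemma hyperplane_ofE:
  assumes "hyperplane_of H (V - {0})" "F2.subspace V" "finite V"
  obtains U where "H = U - {0}" "F2.subspace U" "finite U" "U \<subseteq> V" "card V = 2 * card U"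
proof -
  obtain U where U: "F2.subspace U" "H = U - {0}" "U - {0} \<subseteq> V - {0}"
    using assms by (auto simp: hyperplane_of_def flat_of_def)
  then have "U \<subseteq> V" using assms(2) by (auto simp: subspace_iff)
  then have "finite U" using assms finite_subset by blast
  show thesis
    using that [OF U(2,1) \<open>finite U\<close>] assms U \<open>finite U\<close> hyperplane_of_iff_card by auto
qed

text \<open>The span of \<open>insert w U\<close> lies in \<open>V\<close> and already has
  \<open>2 * card U\<close> elements, so it is \<open>V\<close>; its two cosets of \<open>U\<close>
  are the two alternatives.\<close>

lemma index_two_split:
  assumes "F2.subspace U" "F2.subspace V" "finite V" "U \<subseteq> V" "card V = 2 * card U"
    and "w \<in> V" "w \<notin> U"
  shows "x \<in> V \<longleftrightarrow> x \<in> U \<or> w + x \<in> U"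
proof -
  have U: "F2.span U = U" using assms(1) by (rule F2.span_eq_iff [THEN iffD2])
  have fin: "finite U" using assms finite_subset by blast
  have "F2.span (insert w U) \<subseteq> V"
    using assms by (intro F2.span_minimal) auto
  moreover have "card (F2.span (insert w U)) = card V"
    using card_span_insert [of U w] U fin assms by simp
  ultimately have "V = F2.span (insert w U)"
    using assms(3) by (metis card_subset_eq)
  also have "\<dots> = U \<union> (+) w ` U"
    by (simp only: span_insert_eq U)
  finally show ?thesis
    by (simp only: Un_iff vec2_mem_translation_iff)
qed

text \<open>The quotient of \<open>V\<close> by \<open>U\<close> has order two. Hence the indicator
  of the complement of \<open>U\<close> is additive on \<open>V\<close>: it is the linear form with
  kernel \<open>U\<close>.\<close>

lemma index_two_add:
  assumes "F2.subspace U" "F2.subspace V" "finite V" "U \<subseteq> V" "card V = 2 * card U"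
    and "x \<in> V" "y \<in> V"
  shows "x + y \<in> U \<longleftrightarrow> (x \<in> U \<longleftrightarrow> y \<in> U)"
  using index_two_split [OF assms(1-6), of y] add_in_subspace_iff [OF assms(1), of x y]
    add_in_subspace_iff [OF assms(1), of y x] assms(7)
  by (auto simp: add.commute)

text \<open>Over this field two distinct nonzero vectors are independent, so they extend to a basis
  of \<open>V\<close>; dropping \<open>w\<close> from the basis leaves a hyperplane with the
  required properties.\<close>

lemma hyperplane_separating:
  assumes "F2.subspace V" "finite V" "v \<in> V" "w \<in> V" "v \<noteq> 0" "w \<noteq> 0" "v \<noteq> w"
  obtains U where "F2.subspace U" "U \<subseteq> V" "card V = 2 * card U" "v \<in> U" "w \<notin> U"
proof -
  have "F2.span {w} = {0, w}"
    using span_insert_eq [of w "{}"] by auto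
  then have ind: "F2.independent {v, w}"
    using assms by (simp add: F2.independent_insert)
  obtain B where B: "{v, w} \<subseteq> B" "B \<subseteq> V" "F2.independent B" "V \<subseteq> F2.span B"
    using F2.maximal_independent_subset_extend [of "{v, w}" V] ind assms by auto
  define U where "U = F2.span (B - {w})"
  have Bw: "insert w (B - {w}) = B" using B by auto
  have w: "w \<notin> U"
    using B(1,3) by (auto simp: U_def F2.dependent_def)
  have span: "F2.span B = V"
    using B assms by (simp add: F2.span_minimal subset_antisym)
  have UV: "U \<subseteq> V" unfolding U_def span [symmetric] by (intro F2.span_mono) auto
  have "card V = 2 * card U"
    using card_span_insert [of "B - {w}" w] w UV assms finite_subset
    unfolding U_def Bw span by blast
  moreover have "v \<in> U" using B assms unfolding U_def by (intro F2.span_base) auto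
  ultimately show thesis using that [of U] UV w by (simp add: U_def)
qed

section \<open>Ground sets as quadratic forms\<close>

definition ind :: "vec2 set \<Rightarrow> vec2 \<Rightarrow> bit"
  where "ind E x = of_bool (x \<in> E)"

text \<open>With \<open>B x y = f (x + y) + f x + f y\<close> the seven-term sum is
  \<open>B (a + b) c + B a c + B b c\<close>, so the condition is additivity of the symmetric form
  \<open>B\<close>. The case \<open>a = b = c = 0\<close> forces \<open>f 0 = 0\<close>.\<close>

definition quadratic_on :: "vec2 set \<Rightarrow> (vec2 \<Rightarrow> bit) \<Rightarrow> bool"
  where "quadratic_on V f \<longleftrightarrow> (\<forall>a\<in>V. \<forall>b\<in>V. \<forall>c\<in>V.
    f a + f b + f c + f (a + b) + f (a + c) + f (b + c) + f (a + b + c) = 0)"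

lemma ind_eq_iff [simp]: "ind E x = 1 \<longleftrightarrow> x \<in> E" "ind E x = 0 \<longleftrightarrow> x \<notin> E"
  by (simp_all add: ind_def)

lemma sum_ind:
  assumes "finite F"
  shows "sum (ind E) F = of_nat (card (E \<inter> F))"
  using assms by (simp add: ind_def Int_commute)

lemma of_nat_bit_eq_0_iff: "of_nat n = (0::bit) \<longleftrightarrow> even n"
  by (induction n) auto

text \<open>The sum is grouped by cosets of the span of \<open>a\<close>, \<open>b\<close>,
  \<open>c\<close>. For empty \<open>B\<close> only \<open>x = 0\<close> occurs, which gives the
  seven-term sum plus \<open>f 0\<close>.\<close>

lemma sum_span3:
  fixes f :: "vec2 \<Rightarrow> bit"
  assumes "finite B" "c \<notin> F2.span B" "b \<notin> F2.span (insert c B)"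
    "a \<notin> F2.span (insert b (insert c B))"
  shows "sum f (F2.span (insert a (insert b (insert c B)))) =
    (\<Sum>x\<in>F2.span B. f x + f (a + x) + f (b + x) + f (c + x) + f (a + b + x) + f (a + c + x)
      + f (b + c + x) + f (a + b + c + x))"
  using assms
  by (simp add: sum_span_insert finite_span ac_simps)

text \<open>Add the identities for the triples \<open>a + x, b, c\<close> and
  \<open>x, b, c\<close>: the terms \<open>f b\<close>, \<open>f c\<close> and
  \<open>f (b + c)\<close> cancel.\<close>

lemma quadratic_on_affine:
  assumes "quadratic_on V f" "F2.subspace V" "a \<in> V" "b \<in> V" "c \<in> V" "x \<in> V"
  shows "f x + f (a + x) + f (b + x) + f (c + x) + f (a + b + x) + f (a + c + x)
      + f (b + c + x) + f (a + b + c + x) = 0"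
proof -
  have "a + x \<in> V" using assms by (simp add: subspace_iff)
  then have
    "(f (a + x) + f b + f c + f (a + x + b) + f (a + x + c) + f (b + c) + f (a + x + b + c))
      + (f x + f b + f c + f (x + b) + f (x + c) + f (b + c) + f (x + b + c)) = 0"
    using assms unfolding quadratic_on_def by simp
  then show ?thesis
    by (simp only: ac_simps bit_add_self_left)
qed

text \<open>Three-dimensional flats alone yield the identity. Conversely, a subspace of dimension at
  least 3 is a disjoint union of cosets of a three-dimensional one, and the indicator sums to zero
  on each coset.\<close>

lemma class_E3_iff:
  assumes "F2.subspace V" "finite V" "E \<subseteq> V - {0}"
  shows "(E, V - {0}) \<in> class_E3 \<longleftrightarrow> quadratic_on V (ind E)"
proof
  assume E3: "(E, V - {0}) \<in> class_E3"
  have f0: "ind E 0 = 0" using assms by auto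
  show "quadratic_on V (ind E)"
    unfolding quadratic_on_def
  proof (intro ballI)
    fix a b c assume abc: "a \<in> V" "b \<in> V" "c \<in> V"
    let ?Q = "ind E a + ind E b + ind E c + ind E (a + b) + ind E (a + c) + ind E (b + c)
      + ind E (a + b + c)"
    have span: "F2.span {c} = {0, c}" "F2.span {b, c} = {0, c, b, b + c}"
      by (auto simp: span_insert_eq)
    \<comment> \<open>The first three cases are the dependent triples; there the seven terms cancel
      in pairs, up to \<open>ind E 0 = 0\<close>.\<close>
    consider "c = 0" | "b = 0 \<or> b = c" | "a = 0 \<or> a = b \<or> a = c \<or> a = b + c"
      | "c \<notin> F2.span {}" "b \<notin> F2.span {c}" "a \<notin> F2.span {b, c}"
      unfolding span by auto
    then show "?Q = 0"
    proof cases
      case 4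
      let ?U = "F2.span {a, b, c}"
      have UV: "?U \<subseteq> V" using abc assms by (intro F2.span_minimal) auto
      then have fin: "finite ?U" using assms finite_subset by blast
      have "F2.independent {a, b, c}"
        using 4 by (auto simp: F2.independent_insert)
      moreover have "card {a, b, c} = 3"
        using 4 span by auto
      ultimately have "F2.dim ?U = 3"
        by (metis F2.dim_span_eq_card_independent)
      then have "flat_dim (?U - {0}) \<ge> 3"
        by (simp add: flat_dim_eq_dim)
      moreover have "flat_of (?U - {0}) (V - {0})"
        using UV by (auto simp: flat_of_def)
      ultimately have "even (card (E \<inter> (?U - {0})))"
        using E3 by (auto simp: class_E3_def)
      moreover have "E \<inter> (?U - {0}) = E \<inter> ?U" using assms by auto
      ultimately have "sum (ind E) ?U = 0"
        using fin by (simp add: sum_ind of_nat_bit_eq_0_iff)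
      then show ?thesis
        using 4 f0 by (subst (asm) sum_span3) (auto simp: ac_simps)
    qed (use f0 in \<open>auto simp: ac_simps\<close>)
  qed
next
  assume Q: "quadratic_on V (ind E)"
  have "even (card (E \<inter> F))" if F: "flat_of F (V - {0})" "flat_dim F \<ge> 3" for F
  proof -
    obtain U where U: "F2.subspace U" "F = U - {0}" "U - {0} \<subseteq> V - {0}"
      using F by (auto simp: flat_of_def)
    have UV: "U \<subseteq> V" using U assms by (auto simp: subspace_iff)
    then have finU: "finite U" using assms finite_subset by blast
    obtain B where B: "B \<subseteq> U" "F2.independent B" "U \<subseteq> F2.span B" "card B = F2.dim U"
      using F2.basis_exists by blast
    have span: "F2.span B = U"
      using B U by (simp add: F2.span_minimal subset_antisym)
    have finB: "finite B" using B finU finite_subset by blast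
    have "card B \<ge> 3" using F U B by (simp add: flat_dim_eq_dim)
    then obtain a b c B' where B': "B = insert a (insert b (insert c B'))"
      "a \<notin> insert b (insert c B')" "b \<notin> insert c B'" "c \<notin> B'"
      by (auto simp: numeral_3_eq_3 card_le_Suc_iff)
    have indep: "c \<notin> F2.span B'" "b \<notin> F2.span (insert c B')"
        "a \<notin> F2.span (insert b (insert c B'))"
      using B(2) B' by (auto simp: F2.independent_insert)
    have "F2.span B' \<subseteq> V"
      using UV span F2.span_mono [of B' B] B' by auto
    moreover have "a \<in> V" "b \<in> V" "c \<in> V"
      using B(1) B'(1) UV by auto
    ultimately have "sum (ind E) U = 0"
      unfolding span [symmetric] B'(1)
      using finB B'(1) indep
      by (subst sum_span3) (auto intro!: sum.neutral quadratic_on_affine [OF Q assms(1)])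
    then have "even (card (E \<inter> U))"
      using finU by (simp add: sum_ind of_nat_bit_eq_0_iff)
    moreover have "E \<inter> F = E \<inter> U" using U assms by auto
    ultimately show ?thesis by simp
  qed
  moreover have "is_matroid (E, V - {0})"
    using assms by (auto simp: is_matroid_def proj_geometry_def)
  ultimately show "(E, V - {0}) \<in> class_E3"
    by (simp add: class_E3_def)
qed

section \<open>Invariance of \<open>class_E3\<close> under isomorphism\<close>

lemma is_matroidE:
  assumes "is_matroid M"
  obtains E V where "M = (E, V - {0})" "F2.subspace V" "finite V" "E \<subseteq> V - {0}"
  using assms by (cases M) (auto simp: is_matroid_def proj_geometry_def)

lemma is_matroid_if_E3: "M \<in> class_E3 \<Longrightarrow> is_matroid M"
  by (auto simp: class_E3_def)

lemma matroid_iso_refl: "is_matroid M \<Longrightarrow> matroid_iso M M"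
  unfolding matroid_iso_def by (auto intro!: exI [of _ id] F2.linear_id)

lemma class_E3_iso:
  assumes "matroid_iso M N"
  shows "M \<in> class_E3 \<longleftrightarrow> N \<in> class_E3"
proof -
  obtain E V where M: "M = (E, V - {0})" "F2.subspace V" "finite V" "E \<subseteq> V - {0}"
    using assms unfolding matroid_iso_def by (meson is_matroidE)
  obtain D W where N: "N = (D, W - {0})" "F2.subspace W" "finite W" "D \<subseteq> W - {0}"
    using assms unfolding matroid_iso_def by (meson is_matroidE)
  obtain f where lin: "Vector_Spaces.linear scale2 scale2 f"
    and bij: "bij_betw f (V - {0}) (W - {0})" and D: "f ` E = D"
    using assms M N by (auto simp: matroid_iso_def)
  interpret f: Vector_Spaces.linear scale2 scale2 f by (rule lin)
  have "insert (f 0) (f ` (V - {0})) = insert 0 (W - {0})"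
    using bij by (simp add: bij_betw_def f.zero)
  moreover have "insert 0 (V - {0}) = V" "insert 0 (W - {0}) = W"
    using M N by (auto simp: subspace_iff)
  ultimately have img: "f ` V = W"
    by (metis image_insert)
  have ind: "ind D (f x) = ind E x" if "x \<in> V" for x
  proof -
    have "f x \<in> f ` E \<longleftrightarrow> x \<in> E"
    \<comment> \<open>The bijection covers nonzero vectors only; zero lies in neither ground set and
      is fixed by linearity.\<close>
    proof (cases "x = 0")
      case True
      then show ?thesis using D N M f.zero by auto
    next
      case False
      then show ?thesis
        using that bij M(4) by (meson Diff_iff bij_betw_imp_inj_on inj_on_image_mem_iff singletonD)
    qed
    then show ?thesis by (simp add: ind_def D)
  qed
  have "quadratic_on W (ind D) \<longleftrightarrow> quadratic_on V (ind E)"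
    unfolding quadratic_on_def img [symmetric]
    using M(2) by (simp add: f.add [symmetric] ind subspace_iff)
  then show ?thesis
    using M N by (simp add: class_E3_iff)
qed

section \<open>Bose-Burton geometries of order 1 and 2\<close>

text \<open>A flat \<open>W\<close> of dimension at least 3 meets a subspace \<open>U\<close> of
  index at most 4 in a nonzero vector. So \<open>W\<close> and \<open>W \<inter> U\<close> both have
  even size, and so does their difference.\<close>

lemma bose_burton_E3:
  assumes "bose_burton k M" "k \<in> {1, 2}"
  shows "M \<in> class_E3"
proof -
  obtain F G where FG: "proj_geometry G" "flat_of F G" "flat_dim F + k = flat_dim G"
    "M = (G - F, G)"
    using assms by (auto simp: bose_burton_def)
  obtain V where V: "F2.subspace V" "finite V" "G = V - {0}"
    using FG by (auto simp: proj_geometry_def)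
  obtain U where U: "F2.subspace U" "F = U - {0}" "U - {0} \<subseteq> V - {0}"
    using FG V by (auto simp: flat_of_def)
  have UV: "U \<subseteq> V" using U V by (auto simp: subspace_iff)
  have finU: "finite U" using UV V finite_subset by blast
  have cardV: "card V \<le> 4 * card U"
    using FG U V finU assms(2) dim_add_eq_iff_card [of U V k] by (auto simp: flat_dim_eq_dim)
  have posU: "card U > 0" using finU U by (auto simp: card_gt_0_iff subspace_iff)
  have "even (card ((G - F) \<inter> W'))" if W': "flat_of W' G" "flat_dim W' \<ge> 3" for W'
  proof -
    obtain W where W: "F2.subspace W" "W' = W - {0}" "W - {0} \<subseteq> V - {0}"
      using W' V by (auto simp: flat_of_def)
    have WV: "W \<subseteq> V" using W V by (auto simp: subspace_iff)
    have finW: "finite W" using WV V finite_subset by blast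
    have "(2::nat) ^ 3 \<le> 2 ^ F2.dim W"
      using W' W by (intro power_increasing) (auto simp: flat_dim_eq_dim)
    then have cardW: "card W \<ge> 8"
      using card_subspace W finW by simp
    have "\<exists>x \<in> W \<inter> U. x \<noteq> 0"
    proof (rule ccontr)
      assume no: "\<not> (\<exists>x \<in> W \<inter> U. x \<noteq> 0)"
      \<comment> \<open>With trivial intersection, addition embeds \<open>W \<times> U\<close> into
        \<open>V\<close>, which forces \<open>8 * card U\<close> to be at most
        \<open>4 * card U\<close>.\<close>
      have "inj_on (\<lambda>(x, u). x + u) (W \<times> U)"
      proof (rule inj_onI, clarify)
        fix x u y v assume *: "x \<in> W" "u \<in> U" "y \<in> W" "v \<in> U" "x + u = y + v"
        then have "x + y = u + v"
          by (metis add.assoc add.commute vec2_add_self_left)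
        moreover have "x + y \<in> W" "u + v \<in> U" using * W U by (auto simp: subspace_iff)
        ultimately have "x + y = 0" "u + v = 0" using no by auto
        then show "x = y \<and> u = v" by (metis add.right_neutral vec2_add_self_left)
      qed
      then have "card W * card U = card ((\<lambda>(x, u). x + u) ` (W \<times> U))"
        by (simp add: card_image card_cartesian_product)
      also have "\<dots> \<le> card V"
        using V UV WV by (intro card_mono) (auto simp: subspace_iff)
      finally have "card W * card U \<le> 4 * card U" using cardV by (rule le_trans)
      then show False using cardW posU by simp
    qed
    then obtain x where x: "x \<in> W \<inter> U" "x \<noteq> 0" by blast
    have "even (card W)" "even (card (W \<inter> U))"
      using x W U finW even_card_subspace F2.subspace_inter by (auto intro!: even_card_subspace [of _ x])
    moreover have "(G - F) \<inter> W' = W - W \<inter> U"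
      using U W V WV by (auto simp: subspace_iff)
    ultimately show ?thesis
      using finW by (simp add: card_Diff_subset)
  qed
  then show ?thesis
    using FG by (auto simp: class_E3_def is_matroid_def)
qed

section \<open>Semidoubling preserves \<open>class_E3\<close>\<close>

lemma semidoubling_is_matroid:
  assumes "semidoubling_of M N"
  shows "is_matroid M" "is_matroid N"
proof -
  obtain E0 G0 G w H0 where *: "M = (E0, G0)" "is_matroid M" "proj_geometry G"
    "hyperplane_of G0 G" "w \<in> G - G0" "N = (semidoubling_set E0 G0 H0 w, G)"
    using assms by (auto simp: semidoubling_of_def)
  show "is_matroid M" by fact
  obtain V where V: "F2.subspace V" "finite V" "G = V - {0}"
    using * by (auto simp: proj_geometry_def)
  have G0: "E0 \<subseteq> G0" "G0 \<subseteq> G"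
    using * by (auto simp: is_matroid_def hyperplane_of_def flat_of_def)
  have "w + x \<in> G" if "x \<in> G0" for x
  proof -
    have "w + x \<noteq> 0" using that * by (metis Diff_iff add.right_neutral vec2_add_self_left)
    then show ?thesis using that * G0 V by (auto simp: subspace_iff)
  qed
  then show "is_matroid N"
    using * G0 by (auto simp: is_matroid_def semidoubling_set_def)
qed

text \<open>In the coordinates \<open>x + t w\<close> the semidoubling is the form \<open>f0 x + t h x\<close>, where \<open>h\<close> is
  the linear form with kernel \<open>H0\<close>.\<close>

lemma semidoubling_E3:
  assumes "semidoubling_of M N" "M \<in> class_E3"
  shows "N \<in> class_E3"
proof -
  obtain E0 G0 G w H0 where *: "M = (E0, G0)" "is_matroid M" "proj_geometry G"
    "hyperplane_of G0 G" "w \<in> G - G0" "hyperplane_of H0 G0"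
    "N = (semidoubling_set E0 G0 H0 w, G)"
    using assms by (auto simp: semidoubling_of_def)
  obtain V where V: "F2.subspace V" "finite V" "G = V - {0}"
    using * by (auto simp: proj_geometry_def)
  obtain U where U: "G0 = U - {0}" "F2.subspace U" "finite U" "U \<subseteq> V" "card V = 2 * card U"
    using * V hyperplane_ofE by metis
  obtain H where H: "H0 = H - {0}" "F2.subspace H" "finite H" "H \<subseteq> U" "card U = 2 * card H"
    using * U hyperplane_ofE by metis
  have E0: "E0 \<subseteq> U - {0}" using * U by (auto simp: is_matroid_def)
  have w: "w \<in> V" "w \<notin> U" using * U V by auto
  define E where "E = semidoubling_set E0 G0 H0 w"
  define f where "f = ind E0"
  define h where "h = ind (- H)"
  have Q: "quadratic_on U f"
    using assms(2) U E0 * by (simp add: class_E3_iff f_def)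
  have h_add: "h (x + y) = h x + h y" if "x \<in> U" "y \<in> U" for x y
    using index_two_add [OF H(2) U(2,3) H(4,5) that] by (simp add: h_def ind_def)
  have wU: "w + x \<notin> U" if "x \<in> U" for x
    using that w add_in_subspace_iff [OF U(2) that, of w] by (simp add: add.commute)
  have E1: "ind E x = f x" if "x \<in> U" for x
  proof -
    have "w + y \<noteq> x" if "y \<in> E0 \<or> y \<in> G0" for y
      using that E0 U(1) wU \<open>x \<in> U\<close> by blast
    then show ?thesis
      by (auto simp: E_def semidoubling_set_def f_def ind_def)
  qed
  have E2: "ind E (w + x) = f x + h x" if "x \<in> U" for x
  proof -
    have "w + x \<notin> E0" using wU that E0 by blast
    then have "w + x \<in> E \<longleftrightarrow> x \<in> sym_diff E0 (G0 - H0)"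
      by (auto simp: E_def semidoubling_set_def)
    \<comment> \<open>At \<open>x = 0\<close> both sides are false, as zero lies in \<open>H\<close>
      but not in \<open>E0\<close> or \<open>G0\<close>.\<close>
    also have "\<dots> \<longleftrightarrow> (x \<in> E0 \<longleftrightarrow> x \<in> H)"
      using that E0 U(1) H(1,2,4) by (auto simp: subspace_iff)
    finally show ?thesis by (simp add: f_def h_def ind_def)
  qed
  \<comment> \<open>\<open>g t x\<close> is \<open>x + t w\<close>; with \<open>t\<close> a bit,
    \<open>w + w = 0\<close> makes addition coordinatewise.\<close>
  define g where "g t x = (if t = 0 then x else w + x)" for t :: bit and x
  have g_add: "g s x + g t y = g (s + t) (x + y)" for s t x y
    by (cases s; cases t) (simp_all add: g_def ac_simps)
  have Eg: "ind E (g t x) = f x + t * h x" if "x \<in> U" for t x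
    using that by (cases t) (simp_all add: g_def E1 E2)
  have g_ex: "\<exists>t x. x \<in> U \<and> a = g t x" if "a \<in> V" for a
  proof (cases "a \<in> U")
    case True
    then show ?thesis by (intro exI [of _ 0] exI [of _ a]) (simp add: g_def)
  next
    case False
    then show ?thesis
      using index_two_split [OF U(2) V(1,2) U(4,5) w, of a] that
      by (intro exI [of _ 1] exI [of _ "w + a"]) (simp add: g_def)
  qed
  have "quadratic_on V (ind E)"
    unfolding quadratic_on_def
  proof (intro ballI)
    fix a b c assume "a \<in> V" "b \<in> V" "c \<in> V"
    then obtain r s t x y z where xyz: "x \<in> U" "y \<in> U" "z \<in> U"
      and abc: "a = g r x" "b = g s y" "c = g t z"
      using g_ex by meson
    have in_U: "x + y \<in> U" "x + z \<in> U" "y + z \<in> U" "x + y + z \<in> U"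
      using xyz U by (auto simp: subspace_iff)
    have "f x + f y + f z + f (x + y) + f (x + z) + f (y + z) + f (x + y + z) = 0"
      using Q xyz by (simp add: quadratic_on_def)
    then show "ind E a + ind E b + ind E c + ind E (a + b) + ind E (a + c) + ind E (b + c)
      + ind E (a + b + c) = 0"
      unfolding abc g_add
      using xyz in_U
      \<comment> \<open>The \<open>f\<close> terms vanish by \<open>Q\<close>; after expanding by
        \<open>h_add\<close>, each of \<open>h x\<close>, \<open>h y\<close>, \<open>h z\<close> has
        coefficient zero.\<close>
      by (cases r; cases s; cases t) (simp_all add: Eg h_add ac_simps)
  qed
  moreover have "is_matroid (E, V - {0})"
    using semidoubling_is_matroid [OF assms(1)] * V by (simp add: E_def)
  ultimately show ?thesis
    using * V by (simp add: class_E3_iff E_def is_matroid_def)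
qed

section \<open>Decomposing a quadratic form by semidoublings\<close>

text \<open>Here \<open>w\<close> is a nonzero zero of the form and \<open>y\<close> witnesses that
  \<open>w\<close> is outside the radical. The vector \<open>v\<close> is kept in \<open>U\<close>
  so that the restricted matroid stays nonempty.\<close>

lemma quadratic_semidoubling_step:
  assumes V: "F2.subspace V" "finite V" and E: "E \<subseteq> V - {0}" and Q: "quadratic_on V (ind E)"
    and w: "w \<in> V" "w \<noteq> 0" "w \<notin> E" and y: "y \<in> V" "ind E (w + y) \<noteq> ind E y" and "v \<in> E"
  obtains U where "F2.subspace U" "U \<subset> V" "v \<in> U"
    "semidoubling_of (E \<inter> U, U - {0}) (E, V - {0})"
proof -
  have v: "v \<in> V" "v \<noteq> 0" "v \<noteq> w" using \<open>v \<in> E\<close> E w by auto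
  obtain U where U: "F2.subspace U" "U \<subseteq> V" "card V = 2 * card U" "v \<in> U" "w \<notin> U"
    using hyperplane_separating [OF V v(1) w(1) v(2) w(2) v(3)] by blast
  have finU: "finite U" using U V finite_subset by blast
  \<comment> \<open>Since \<open>ind E w = 0\<close>, the sum \<open>ind E (w + x) + ind E x\<close>
    equals \<open>B w x\<close>; thus \<open>H\<close> is the kernel of \<open>B w\<close> on
    \<open>U\<close>.\<close>
  define H where "H = {x \<in> U. ind E (w + x) = ind E x}"
  have bits: "p + q + p' + q' + r + r' = 0 \<Longrightarrow> r' = r \<longleftrightarrow> (p' = p \<longleftrightarrow> q' = q)"
    for p q p' q' r r' :: bit
    by (cases p; cases q; cases p'; cases q'; cases r; cases r') simp_all
  have h_add: "ind E (w + (x + y)) = ind E (x + y) \<longleftrightarrow>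
      (ind E (w + x) = ind E x \<longleftrightarrow> ind E (w + y) = ind E y)" if "x \<in> V" "y \<in> V" for x y
  proof -
    have "ind E w + ind E x + ind E y + ind E (w + x) + ind E (w + y) + ind E (x + y)
      + ind E (w + x + y) = 0"
      using Q that w by (auto simp: quadratic_on_def)
    moreover have "ind E w = 0" using w by simp
    ultimately show ?thesis
      using bits [of "ind E x" "ind E y" "ind E (w + x)" "ind E (w + y)" "ind E (x + y)"
          "ind E (w + (x + y))"] by (simp add: add.assoc)
  qed
  have E0: "0 \<notin> E" using E by auto
  have H: "F2.subspace H"
    unfolding subspace_iff
  proof (intro conjI ballI)
    show "0 \<in> H" using U(1) w E0 by (simp add: H_def subspace_iff ind_def)
    fix x y assume "x \<in> H" "y \<in> H"
    then show "x + y \<in> H"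
      using h_add [of x y] U(1,2) unfolding H_def subspace_iff by blast
  qed
  have split: "x \<in> V \<longleftrightarrow> x \<in> U \<or> w + x \<in> U" for x
    using index_two_split [OF U(1) V U(2,3) w(1) U(5)] .
  \<comment> \<open>The form \<open>B w\<close> must be nonzero on \<open>U\<close>, not just on
    \<open>V\<close>. It takes the same value at \<open>y\<close> and \<open>w + y\<close>, one of
    which lies in \<open>U\<close>.\<close>
  obtain u where u: "u \<in> U" "ind E (w + u) \<noteq> ind E u"
  proof (cases "y \<in> U")
    case True
    then show thesis using that y by blast
  next
    case False
    then have "w + y \<in> U" using split y by blast
    moreover have "ind E (w + (w + y)) \<noteq> ind E (w + y)" using y by simp
    ultimately show thesis using that by blast
  qed
  have spanH: "F2.span H = H" using H by (rule F2.span_eq_iff [THEN iffD2])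
  have "U = F2.span (insert u H)"
  proof -
    \<comment> \<open>Off the kernel \<open>B w\<close> takes the value 1 at both \<open>u\<close>
      and \<open>x\<close>, so it vanishes at \<open>u + x\<close>; hence \<open>H\<close> has index
      two in \<open>U\<close>.\<close>
    have "x \<in> H \<or> u + x \<in> H" if "x \<in> U" for x
    proof (cases "x \<in> H")
      case False
      have "u \<in> V" "x \<in> V" "u + x \<in> U"
        using that u U(1,2) by (auto simp: subspace_iff)
      then show ?thesis
        using False that u h_add [of u x] unfolding H_def by blast
    qed simp
    then have "U \<subseteq> H \<union> (+) u ` H"
      by (simp add: subset_iff vec2_mem_translation_iff)
    moreover have "F2.span (insert u H) \<subseteq> U"
      using u U by (intro F2.span_minimal) (auto simp: H_def)
    ultimately show ?thesis unfolding span_insert_eq spanH by (rule subset_antisym)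
  qed
  moreover have "u \<notin> H" using u by (simp add: H_def)
  moreover have "finite H" using finU by (simp add: H_def)
  ultimately have cardH: "card U = 2 * card H"
    using card_span_insert [of H u] spanH by simp
  have HU: "hyperplane_of (H - {0}) (U - {0})"
    using H U finU \<open>finite H\<close> cardH by (subst hyperplane_of_iff_card) (auto simp: H_def)
  have UV: "hyperplane_of (U - {0}) (V - {0})"
    using U V finU by (subst hyperplane_of_iff_card) auto
  let ?S = "semidoubling_set (E \<inter> U) (U - {0}) (H - {0}) w"
  have wU: "w + x \<notin> U" if "x \<in> U" for x
    using that U(5) add_in_subspace_iff [OF U(1) that, of w] by (simp add: add.commute)
  have S_w: "w + x \<in> ?S \<longleftrightarrow> w + x \<in> E" if "x \<in> U" for x
  proof -
    have "w + x \<in> ?S \<longleftrightarrow> x \<in> sym_diff (E \<inter> U) (U - {0} - (H - {0}))"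
      using wU that by (auto simp: semidoubling_set_def)
    \<comment> \<open>For nonzero \<open>x\<close>, leaving \<open>H\<close> means exactly that
      \<open>x\<close> and \<open>w + x\<close> differ in membership of \<open>E\<close>. For
      \<open>x = 0\<close> both sides are false because \<open>w \<notin> E\<close>.\<close>
    also have "\<dots> \<longleftrightarrow> w + x \<in> E"
      using that w E0 by (cases "x = 0") (auto simp: H_def ind_def split: if_splits)
    finally show ?thesis .
  qed
  have S_U: "x \<in> ?S \<longleftrightarrow> x \<in> E" if "x \<in> U" for x
    using that wU by (auto simp: semidoubling_set_def)
  have "x \<in> ?S \<longleftrightarrow> x \<in> E" for x
  proof (cases "x \<in> V")
    case True
    then show ?thesis using split S_w S_U by (metis vec2_add_self_left)
  next
    case False
    moreover have "?S \<subseteq> V"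
      using U w V by (auto simp: semidoubling_set_def subspace_iff)
    ultimately show ?thesis using E by auto
  qed
  then have "?S = E" by blast
  moreover have "is_matroid (E \<inter> U, U - {0})"
    using E U(1) finU by (auto simp: is_matroid_def proj_geometry_def)
  moreover have "proj_geometry (V - {0})" using V by (auto simp: proj_geometry_def)
  moreover have "w \<in> (V - {0}) - (U - {0})" using w U by auto
  ultimately have "semidoubling_of (E \<inter> U, U - {0}) (E, V - {0})"
    unfolding semidoubling_of_def using HU UV by metis
  moreover have "U \<subset> V" using U w by blast
  ultimately show thesis using that U by blast
qed

text \<open>The hypothesis \<open>rad\<close> places every zero of the form in the radical. The
  zeros \<open>Z\<close> then form a subspace, and the chain from \<open>Z\<close> through
  \<open>?Z1\<close> to \<open>?Z2\<close> reaches \<open>V\<close> after one or two steps, giving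
  the order.\<close>

lemma quadratic_bose_burton:
  assumes V: "F2.subspace V" "finite V" and E: "E \<subseteq> V - {0}" "E \<noteq> {}"
    and Q: "quadratic_on V (ind E)"
    and rad: "\<And>w y. w \<in> V \<Longrightarrow> w \<notin> E \<Longrightarrow> y \<in> V \<Longrightarrow> ind E (w + y) = ind E y"
  shows "\<exists>k\<in>{1, 2}. bose_burton k (E, V - {0})"
proof -
  define Z where "Z = V - E"
  have Z: "F2.subspace Z"
    unfolding subspace_iff
  proof (intro conjI ballI)
    show "0 \<in> Z" using V E by (auto simp: Z_def subspace_iff)
    show "x + y \<in> Z" if "x \<in> Z" "y \<in> Z" for x y
      using that V rad [of x y] by (simp add: Z_def subspace_iff ind_def)
  qed
  have finZ: "finite Z" "Z \<subseteq> V" using V by (auto simp: Z_def)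
  have bb: "bose_burton k (E, V - {0})" if "card V = 2 ^ k * card Z" for k
  proof -
    have "F2.dim Z + k = F2.dim V"
      using that dim_add_eq_iff_card Z V finZ by blast
    moreover have "E = (V - {0}) - (Z - {0})" using E by (auto simp: Z_def)
    moreover have "flat_of (Z - {0}) (V - {0})" "proj_geometry (V - {0})"
      using Z V finZ by (auto simp: flat_of_def proj_geometry_def)
    ultimately show ?thesis
      using Z V flat_dim_eq_dim unfolding bose_burton_def by metis
  qed
  have spanZ: "F2.span Z = Z" using Z by (rule F2.span_eq_iff [THEN iffD2])
  obtain a where a: "a \<in> V" "a \<notin> Z" using E by (auto simp: Z_def)
  let ?Z1 = "F2.span (insert a Z)"
  have Z1: "?Z1 \<subseteq> V" "card ?Z1 = 2 * card Z"
    using a finZ V card_span_insert [of Z a] spanZ by (simp_all add: F2.span_minimal)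
  show ?thesis
  proof (cases "?Z1 = V")
    case True
    then show ?thesis using bb [of 1] Z1 by auto
  next
    case False
    then obtain b where b: "b \<in> V" "b \<notin> ?Z1" using Z1 by blast
    let ?Z2 = "F2.span (insert b (insert a Z))"
    have Z2: "?Z2 \<subseteq> V" "card ?Z2 = 4 * card Z"
      using a b finZ V Z1 card_span_insert [of "insert a Z" b]
      by (simp_all add: F2.span_minimal finite_span)
    have "?Z2 = V"
    proof (rule ccontr)
      assume "?Z2 \<noteq> V"
      then obtain c where c: "c \<in> V" "c \<notin> ?Z2" using Z2 by blast
      have in2: "a \<in> ?Z2" "b \<in> ?Z2" "Z \<subseteq> ?Z2" "a + b \<in> ?Z2" "a \<in> ?Z1" "Z \<subseteq> ?Z1"
        by (auto intro: F2.span_base F2.span_add)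
      have "a + b \<notin> ?Z1" "a + c \<notin> ?Z2" "b + c \<notin> ?Z2" "a + b + c \<notin> ?Z2"
        using b c in2 add_in_subspace_iff [OF F2.subspace_span] by blast+
      then have "a \<in> E" "b \<in> E" "c \<in> E" "a + b \<in> E" "a + c \<in> E" "b + c \<in> E" "a + b + c \<in> E"
        using a b c in2 V(1) by (auto simp: Z_def subspace_iff subset_iff)
      moreover have "ind E a + ind E b + ind E c + ind E (a + b) + ind E (a + c) + ind E (b + c)
        + ind E (a + b + c) = 0"
        using Q a b c by (simp add: quadratic_on_def)
      \<comment> \<open>Seven ones sum to 1 in \<open>bit\<close>.\<close>
      ultimately show False by (simp add: ind_def)
    qed
    then show ?thesis using bb [of 2] Z2 by auto
  qed
qed

text \<open>Each step restricts to a proper subspace that meets \<open>E\<close>, so the descent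
  ends in the radical case. The matroids are reached exactly, not only up to isomorphism.\<close>

lemma quadratic_arises:
  assumes "finite V" "F2.subspace V" "E \<subseteq> V - {0}" "E \<noteq> {}" "quadratic_on V (ind E)"
  shows "\<exists>k\<in>{1, 2}. \<exists>M0. bose_burton k M0 \<and> semidoubling_of\<^sup>*\<^sup>* M0 (E, V - {0})"
  using assms
proof (induction V arbitrary: E rule: finite_psubset_induct)
  case (psubset V)
  show ?case
  proof (cases "\<exists>w\<in>V. \<exists>y\<in>V. w \<notin> E \<and> ind E (w + y) \<noteq> ind E y")
    case True
    then obtain w y where wy: "w \<in> V" "y \<in> V" "w \<notin> E" "ind E (w + y) \<noteq> ind E y" by blast
    then have "w \<noteq> 0" by auto
    obtain v where "v \<in> E" using psubset.prems by blast
    then obtain U where U: "F2.subspace U" "U \<subset> V" "v \<in> U"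
      "semidoubling_of (E \<inter> U, U - {0}) (E, V - {0})"
      using quadratic_semidoubling_step psubset.hyps psubset.prems wy \<open>w \<noteq> 0\<close> by metis
    have "ind (E \<inter> U) x = ind E x" if "x \<in> U" for x
      using that by (simp add: ind_def)
    then have "quadratic_on U (ind (E \<inter> U))"
      using psubset.prems(4) U(1,2) by (simp add: quadratic_on_def subspace_iff psubset_eq subset_iff)
    then obtain k M0 where "k \<in> {1, 2}" "bose_burton k M0" "semidoubling_of\<^sup>*\<^sup>* M0 (E \<inter> U, U - {0})"
      using psubset.IH [OF U(2,1), of "E \<inter> U"] psubset.prems \<open>v \<in> E\<close> U(3) by blast
    then show ?thesis
      using U(4) by (meson rtranclp.rtrancl_into_rtrancl)
  next
    case False
    have "\<exists>k\<in>{1, 2}. bose_burton k (E, V - {0})"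
      by (rule quadratic_bose_burton) (use psubset.hyps psubset.prems False in \<open>blast+\<close>)
    then show ?thesis by blast
  qed
qed

section \<open>Sequences of semidoublings and the equivalence\<close>

lemma arises_if_semidoubling_rtranclp:
  assumes "semidoubling_of\<^sup>*\<^sup>* M0 M" "is_matroid M0"
  shows "arises_by_semidoublings M0 M"
proof -
  obtain s Ms where Ms: "Ms 0 = M0" "Ms s = M" "\<forall>i<s. semidoubling_of (Ms i) (Ms (Suc i))"
    using assms(1) by (auto dest!: rtranclp_imp_relpowp simp: relpowp_fun_conv)
  \<comment> \<open>Each term of the chain is itself a semidoubling of its predecessor, so identity
    maps serve as the isomorphisms.\<close>
  have "\<forall>i<s. matroid_iso (Ms (Suc i)) (Ms (Suc i))"
    using Ms semidoubling_is_matroid matroid_iso_refl by blast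
  moreover have "is_matroid M"
    using assms by (metis rtranclp.cases semidoubling_is_matroid(2))
  ultimately show ?thesis
    unfolding arises_by_semidoublings_def using Ms matroid_iso_refl by blast
qed

lemma class_E3_if_arises:
  assumes "arises_by_semidoublings M0 M" "M0 \<in> class_E3"
  shows "M \<in> class_E3"
proof -
  obtain s Ms where Ms: "Ms 0 = M0" "matroid_iso (Ms s) M"
    "\<And>i. i < s \<Longrightarrow> \<exists>N. semidoubling_of (Ms i) N \<and> matroid_iso (Ms (Suc i)) N"
    using assms(1) unfolding arises_by_semidoublings_def by blast
  have "i \<le> s \<Longrightarrow> Ms i \<in> class_E3" for i
  proof (induction i)
    case (Suc i)
    then show ?case
      using Ms(3) [of i] semidoubling_E3 class_E3_iso by (meson Suc_leD Suc_le_lessD)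
  qed (simp add: Ms assms)
  then show ?thesis using Ms(2) class_E3_iso by blast
qed

theorem theorem4p3:
  fixes M :: matroid
  assumes "nonempty_matroid M"
  shows "M \<in> class_E3 \<longleftrightarrow>
    (\<exists>k M0. k \<in> {1, 2} \<and> bose_burton k M0 \<and> arises_by_semidoublings M0 M)"
proof
  assume E3: "M \<in> class_E3"
  obtain E V where M: "M = (E, V - {0})" "F2.subspace V" "finite V" "E \<subseteq> V - {0}"
    using E3 is_matroid_if_E3 is_matroidE by blast
  have "E \<noteq> {}" using assms M by (simp add: nonempty_matroid_def)
  moreover have "quadratic_on V (ind E)"
    using M E3 by (simp add: class_E3_iff)
  ultimately obtain k M0 where k: "k \<in> {1, 2}" "bose_burton k M0" "semidoubling_of\<^sup>*\<^sup>* M0 M"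
    using quadratic_arises M by blast
  then have "arises_by_semidoublings M0 M"
    using arises_if_semidoubling_rtranclp bose_burton_E3 is_matroid_if_E3 by blast
  with k show "\<exists>k M0. k \<in> {1, 2} \<and> bose_burton k M0 \<and> arises_by_semidoublings M0 M"
    by blast
next
  assume "\<exists>k M0. k \<in> {1, 2} \<and> bose_burton k M0 \<and> arises_by_semidoublings M0 M"
  then show "M \<in> class_E3"
    using bose_burton_E3 class_E3_if_arises by blast
qed

end
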